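(* Let $k \ge 2$ and let $n \ge m \ge 1$ be integers. Then $d_k(K_{m,n}) = m + \left\lceil \frac{n}{2} \right\rceil - 1$.
   Context: $K_{m,n}$ is the complete bipartite graph with parts of sizes $m$ and $n$. The $k$-move deduction game ($k$ a positive integer) on a finite graph $G$: a layout places a finite number of searchers on vertices of $G$ (several searchers may share a vertex). Every searcher is initially mobile. A vertex is protected once it has been occupied by some searcher (so initially occupied vertices are protected); other vertices are unprotected. The game proceeds in stages. At each stage, for every vertex $v$ that has at least one unprotected neighbour: if the number of mobile searchers on $v$ is at least the number of unprotected neighbours of $v$, then the mobile searchers on $v$ move to the unprotected neighbours of $v$ so that each unprotected neighbour receives at least one searcher; excess mobile searchers on $v$ may also move to any of these unprotected neighbours. All moves in a stage happen simultaneously, newly occupied vertices become protected, and a searcher that has moved $k$ times becomes immobile. The process repeats until all vertices are protected or no searcher can move. A layout is successful if all vertices of $G$ end up protected. The $k$-move deduction number $d_k(G)$ is the minimum number of searchers in a successful layout on $G$. *)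

theory Defs
  imports Complex_Main "Graph_Theory.Graph_Theory"
begin

text \<open>
  Searchers are labelled by the numbers below \<open>N\<close>; the values of \<open>location\<close> and
  \<open>moves\<close> at other arguments are irrelevant. Finite simple graphs are the symmetric
  digraphs of locale \<^locale>\<open>graph\<close>.
\<close>

record 'a game_state =
  location :: "nat \<Rightarrow> 'a"
  moves :: "nat \<Rightarrow> nat"
  protected_verts :: "'a set"

definition is_layout :: "('a, 'b) pre_digraph \<Rightarrow> nat \<Rightarrow> (nat \<Rightarrow> 'a) \<Rightarrow> bool" where
  "is_layout G N L \<longleftrightarrow> L ` {..<N} \<subseteq> verts G"

definition initial_state :: "nat \<Rightarrow> (nat \<Rightarrow> 'a) \<Rightarrow> 'a game_state" where
  "initial_state N L = \<lparr> location = L, moves = (\<lambda>_. 0), protected_verts = L ` {..<N} \<rparr>"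

definition unprotected_nbrs :: "('a, 'b) pre_digraph \<Rightarrow> 'a game_state \<Rightarrow> 'a \<Rightarrow> 'a set" where
  "unprotected_nbrs G s v = {u. v \<rightarrow>\<^bsub>G\<^esub> u \<and> u \<notin> protected_verts s}"

definition mobile_at :: "nat \<Rightarrow> nat \<Rightarrow> 'a game_state \<Rightarrow> 'a \<Rightarrow> nat set" where
  "mobile_at k N s v = {i. i < N \<and> location s i = v \<and> moves s i < k}"

definition fires :: "nat \<Rightarrow> ('a, 'b) pre_digraph \<Rightarrow> nat \<Rightarrow> 'a game_state \<Rightarrow> 'a \<Rightarrow> bool" where
  "fires k G N s v \<longleftrightarrow> v \<in> verts G \<and> unprotected_nbrs G s v \<noteq> {} \<and>
     card (unprotected_nbrs G s v) \<le> card (mobile_at k N s v)"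

text \<open>
  \<open>M\<close> is the set of searchers that move during the stage. Every vertex able to fire must
  do so, all of them simultaneously; only the use made of excess searchers is a free choice:
  each may stay put or join the searchers sent to any unprotected neighbour.
  If no vertex can fire, then \<open>M\<close> is empty and the state does not change.
\<close>

definition stage :: "nat \<Rightarrow> ('a, 'b) pre_digraph \<Rightarrow> nat \<Rightarrow> 'a game_state \<Rightarrow> 'a game_state \<Rightarrow> bool" where
  "stage k G N s t \<longleftrightarrow> (\<exists>M.
     (\<forall>i\<in>M. \<exists>v. fires k G N s v \<and> i \<in> mobile_at k N s v \<and>
        location t i \<in> unprotected_nbrs G s v) \<and>
     (\<forall>i. i \<notin> M \<longrightarrow> location t i = location s i) \<and>
     (\<forall>v. fires k G N s v \<longrightarrow>
        unprotected_nbrs G s v \<subseteq> location t ` (M \<inter> mobile_at k N s v)) \<and>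
     moves t = (\<lambda>i. if i \<in> M then Suc (moves s i) else moves s i) \<and>
     protected_verts t = protected_verts s \<union> location t ` M)"

text \<open>
  A layout is successful if the excess searchers can be used in such a way that all vertices
  end up protected.
\<close>

definition successful :: "nat \<Rightarrow> ('a, 'b) pre_digraph \<Rightarrow> nat \<Rightarrow> (nat \<Rightarrow> 'a) \<Rightarrow> bool" where
  "successful k G N L \<longleftrightarrow> is_layout G N L \<and>
     (\<exists>t. (stage k G N)\<^sup>*\<^sup>* (initial_state N L) t \<and> verts G \<subseteq> protected_verts t)"

definition deduction_number :: "nat \<Rightarrow> ('a, 'b) pre_digraph \<Rightarrow> nat" where
  "deduction_number k G = (LEAST N. \<exists>L. successful k G N L)"

end

theory Submission
  imports Defs
begin

text \<open>
  Lower bound: let \<open>A\<close> be the part of a vertex that fires in the first stage, \<open>B\<close> the other part,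
  and \<open>a\<close> the number of vertices of \<open>A\<close> occupied at the start. Counting the searchers before the
  first stage gives \<open>N \<ge> \<bar>B\<bar> + a - 1\<close>. After it \<open>B\<close> is protected. If no vertex of \<open>B\<close> fired as well,
  then every vertex of \<open>B\<close> holds a searcher when one of them fires in the second stage, so
  \<open>N \<ge> \<bar>A\<bar> - a + \<bar>B\<bar> - 1\<close>. Adding up, \<open>2 N + 2 \<ge> 2 \<bar>B\<bar> + \<bar>A\<bar>\<close>, which is weakest when \<open>A\<close> is the larger
  part. If both parts fire in the first stage, then even \<open>N \<ge> \<bar>A\<bar> + \<bar>B\<bar> - 2\<close>.

  Upper bound: leave one vertex \<open>u\<close> of the smaller part free, occupy all its other vertices and half
  of the larger part, each by one searcher. The searchers on the larger part all move to \<open>u\<close>, and from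
  there to the other half.
\<close>

section \<open>Counting and maps on finite sets\<close>

text \<open>Elements of \<open>T\<close> land in \<open>V\<close>, so points of \<open>X\<close>
  outside \<open>V\<close> must be hit from outside \<open>T\<close>. In use, \<open>T\<close>
  consists of the mobile searchers on the firing vertices \<open>V\<close>, and \<open>X\<close> of
  occupied vertices.\<close>

lemma card_occupied_bound:
  assumes "finite S" "X \<subseteq> f ` S" "T \<subseteq> S" "f ` T \<subseteq> V"
  shows "card T + card (X - V) \<le> card S"
proof -
  have "X - V \<subseteq> f ` (S - T)"
    using assms(2,4) by blast
  then have "card (X - V) \<le> card (S - T)"
    using assms(1) by (meson finite_Diff surj_card_le)
  moreover have "card T + card (S - T) = card S"
    using assms(1,3) by (metis card_Diff_subset card_mono finite_subset le_add_diff_inverse)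
  ultimately show ?thesis
    by linarith
qed

text \<open>Inject \<open>U\<close> into \<open>T\<close>, invert, and send the remaining elements
  to a fixed \<open>u\<close>. This gives every searcher on a firing vertex a destination.\<close>

lemma ex_onto_map:
  assumes "finite T" "finite U" "U \<noteq> {}" "card U \<le> card T"
  shows "\<exists>f. f ` T = U"
proof -
  obtain g where g: "g ` U \<subseteq> T" "inj_on g U"
    using assms card_le_inj by blast
  obtain u where u: "u \<in> U"
    using assms(3) by blast
  have "(\<lambda>x. if x \<in> g ` U then inv_into U g x else u) ` T = U" (is "?f ` T = U")
  proof
    show "?f ` T \<subseteq> U"
      using u by (auto simp: inv_into_into)
    show "U \<subseteq> ?f ` T"
    proof
      fix y assume "y \<in> U"
      then have "?f (g y) = y" "g y \<in> T"
        using g by auto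
      then show "y \<in> ?f ` T"
        using image_eqI[of y ?f "g y" T] by metis
    qed
  qed
  then show ?thesis
    by (intro exI[of _ ?f])
qed

section \<open>Stages of the game on general graphs\<close>

lemma finite_mobile_at: "finite (mobile_at k N s v)"
  by (simp add: mobile_at_def)

lemma mobile_at_subset: "mobile_at k N s v \<subseteq> {..<N}"
  by (auto simp: mobile_at_def)

lemma location_mobile_at: "location s ` mobile_at k N s v \<subseteq> {v}"
  by (auto simp: mobile_at_def)

text \<open>Finiteness matters because \<open>card\<close> is 0 on infinite sets: a vertex with
  infinitely many unprotected neighbours would fire without any searcher.\<close>

lemma fires_occupied:
  assumes "fires k G N s v" "finite (unprotected_nbrs G s v)"
  shows "v \<in> location s ` {..<N}"
proof -
  have "card (mobile_at k N s v) > 0"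
    using assms by (metis card_gt_0_iff fires_def less_le_trans)
  then obtain i where "i \<in> mobile_at k N s v"
    by (metis card.empty ex_in_conv less_irrefl)
  then show ?thesis
    by (auto simp: mobile_at_def)
qed

lemma stage_no_fires_eq:
  assumes "stage k G N s t" "\<nexists>v. fires k G N s v"
  shows "t = s"
proof -
  obtain M where M: "\<forall>i\<in>M. \<exists>v. fires k G N s v \<and> i \<in> mobile_at k N s v \<and>
        location t i \<in> unprotected_nbrs G s v"
     "\<forall>i. i \<notin> M \<longrightarrow> location t i = location s i"
     "moves t = (\<lambda>i. if i \<in> M then Suc (moves s i) else moves s i)"
     "protected_verts t = protected_verts s \<union> location t ` M"
    using assms(1) unfolding stage_def by blast
  have "M = {}"
    using M(1) assms(2) by blast
  then show ?thesis
    using M by (intro game_state.equality) auto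
qed

text \<open>A run may begin with idle stages; these leave the state unchanged, so the induction
  skips them.\<close>

lemma stages_step:
  assumes "(stage k G N)\<^sup>*\<^sup>* s t" "\<not> W \<subseteq> protected_verts s" "W \<subseteq> protected_verts t"
  shows "\<exists>v s'. fires k G N s v \<and> stage k G N s s' \<and> (stage k G N)\<^sup>*\<^sup>* s' t"
  using assms
proof (induction rule: converse_rtranclp_induct)
  case base
  then show ?case by blast
next
  case (step s s')
  then show ?case
    by (metis stage_no_fires_eq)
qed

lemma stage_protected_mono:
  assumes "stage k G N s t"
  shows "protected_verts s \<subseteq> protected_verts t"
proof -
  obtain M where "protected_verts t = protected_verts s \<union> location t ` M"
    using assms unfolding stage_def by blast
  then show ?thesis
    by simp
qed

lemma stage_protects:
  assumes "stage k G N s t" "fires k G N s v" "v \<rightarrow>\<^bsub>G\<^esub> x"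
  shows "x \<in> protected_verts t"
proof (cases "x \<in> protected_verts s")
  case True
  then show ?thesis using stage_protected_mono[OF assms(1)] by blast
next
  case False
  then have "x \<in> unprotected_nbrs G s v"
    using assms(3) by (simp add: unprotected_nbrs_def)
  moreover obtain M where "unprotected_nbrs G s v \<subseteq> location t ` (M \<inter> mobile_at k N s v)"
    and "protected_verts t = protected_verts s \<union> location t ` M"
    using assms(1,2) unfolding stage_def by meson
  ultimately show ?thesis
    by blast
qed

text \<open>Excess searchers could stay put, but the upper bound wants all of them to gather on one
  vertex.\<close>

lemma ex_stage_moving_all:
  assumes "finite (verts G)" "wf_digraph G"
  obtains t where "stage k G N s t"
    "\<And>v i. fires k G N s v \<Longrightarrow> i \<in> mobile_at k N s v \<Longrightarrow>
       location t i \<in> unprotected_nbrs G s v \<and> moves t i = Suc (moves s i)"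
proof -
  have "finite (unprotected_nbrs G s v)" for v
    using assms by (auto simp: unprotected_nbrs_def arcs_ends_conv wf_digraph.head_in_verts
        intro!: finite_subset[OF _ assms(1)])
  then have "\<exists>f. fires k G N s v \<longrightarrow> f ` mobile_at k N s v = unprotected_nbrs G s v" for v
    using ex_onto_map[OF finite_mobile_at] by (metis fires_def)
  then obtain f where f:
    "\<And>v. fires k G N s v \<Longrightarrow> f v ` mobile_at k N s v = unprotected_nbrs G s v"
    by metis
  \<comment> \<open>A searcher is mobile at its own location only, so the maps \<open>f v\<close>
    glue to a single map on \<open>M\<close>.\<close>
  define M where "M = {i. fires k G N s (location s i) \<and> i \<in> mobile_at k N s (location s i)}"
  define loc where "loc i = (if i \<in> M then f (location s i) i else location s i)" for i
  define t where "t = \<lparr> location = loc,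
    moves = (\<lambda>i. if i \<in> M then Suc (moves s i) else moves s i),
    protected_verts = protected_verts s \<union> loc ` M \<rparr>"
  have M: "i \<in> M" "loc i = f v i" if "fires k G N s v" "i \<in> mobile_at k N s v" for v i
    using that by (auto simp: M_def loc_def mobile_at_def)
  have loc: "loc i \<in> unprotected_nbrs G s v"
    if "fires k G N s v" "i \<in> mobile_at k N s v" for v i
    using M[OF that] f that by auto
  have onto: "unprotected_nbrs G s v \<subseteq> loc ` (M \<inter> mobile_at k N s v)" if "fires k G N s v" for v
    using M that f[OF that] by (smt (verit) IntI image_iff subsetI)
  have "stage k G N s t"
    unfolding stage_def
  proof (intro exI[of _ M] conjI)
    show "\<forall>i\<in>M. \<exists>v. fires k G N s v \<and> i \<in> mobile_at k N s v \<and>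
        location t i \<in> unprotected_nbrs G s v"
      using loc by (auto simp: t_def M_def)
    show "\<forall>v. fires k G N s v \<longrightarrow>
        unprotected_nbrs G s v \<subseteq> location t ` (M \<inter> mobile_at k N s v)"
      using onto by (simp add: t_def)
  qed (auto simp: t_def loc_def)
  with loc M(1) that show thesis
    by (simp add: t_def)
qed

section \<open>Complete bipartite graphs: lower bound\<close>

locale bipartition =
  fixes A B :: "'a set" and G :: "('a, 'b) pre_digraph"
  assumes verts: "verts G = A \<union> B" and disjoint: "A \<inter> B = {}"
    and ends: "arcs_ends G = A \<times> B \<union> B \<times> A"
    and graph: "graph G"
begin

lemma swap: "bipartition B A G"
  using verts disjoint ends graph by (auto simp: bipartition_def)

lemma fin: "finite A" "finite B"
  using graph verts by (metis fin_digraph.finite_verts digraph_def finite_Un graph_def)+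

lemma nbrs: "v \<in> A \<Longrightarrow> unprotected_nbrs G s v = B - protected_verts s"
  using disjoint ends by (auto simp: unprotected_nbrs_def)

lemma nbrs': "v \<in> B \<Longrightarrow> unprotected_nbrs G s v = A - protected_verts s"
  using disjoint ends by (auto simp: unprotected_nbrs_def)

text \<open>The sizes of the parts are not compared, so the bound can be applied with the parts
  exchanged, whichever part \<open>v\<close> lies in.\<close>

lemma searchers_lower_bound_aux:
  assumes final: "verts G \<subseteq> protected_verts t"
    and layout: "is_layout G N L" and st: "stage k G N (initial_state N L) s"
    and rest: "(stage k G N)\<^sup>*\<^sup>* s t"
    and v: "fires k G N (initial_state N L) v" "v \<in> A"
  shows "2 * card B + card A \<le> 2 * N + 2"
proof -
  define P where "P = L ` {..<N}"
  define s0 where "s0 = initial_state N L"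
  have s0: "location s0 = L" "protected_verts s0 = P"
    by (simp_all add: s0_def initial_state_def P_def)
  note st = st[folded s0_def] and v = v[folded s0_def]
  have finP: "finite P" by (simp add: P_def)
  have cA: "card (A \<inter> P) + card (A - P) = card A"
    using fin card_Diff_subset_Int[of A P] by (simp add: card_mono)
  have cB: "card (B \<inter> P) + card (B - P) = card B"
    using fin card_Diff_subset_Int[of B P] by (simp add: card_mono)
  have P: "P = (A \<inter> P) \<union> (B \<inter> P)"
    using layout verts by (auto simp: P_def is_layout_def)
  have cP: "card P = card (A \<inter> P) + card (B \<inter> P)"
    by (subst P, subst card_Un_disjoint) (use fin disjoint in auto)
  have vP: "v \<in> P"
    using fires_occupied[OF v(1)] nbrs[OF v(2)] fin s0 by (simp add: P_def)
  have mv: "card (B - P) \<le> card (mobile_at k N s0 v)" and Bne: "B - P \<noteq> {}"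
    using v nbrs s0 by (auto simp: fires_def)
  \<comment> \<open>The vertex \<open>v\<close> is left out of \<open>P\<close>, as its mobile
    searchers are already counted; this costs the 1 in the next bound.\<close>
  have first: "card (mobile_at k N s0 v) + card (P - {v}) \<le> N"
    using card_occupied_bound[OF _ _ mobile_at_subset location_mobile_at, of N P s0 k v] s0
    by (simp add: P_def)
  have 1: "card B + card (A \<inter> P) \<le> N + 1"
    using first mv cP cB vP finP by (simp add: card_Diff_singleton)
  have Bprot: "B \<subseteq> protected_verts s"
    using stage_protects[OF st v(1)] v(2) ends by blast
  show ?thesis
  proof (cases "\<exists>w\<in>B. fires k G N s0 w")
    case True
    then obtain w where w: "w \<in> B" "fires k G N s0 w" by blast
    have wP: "w \<in> P"
      using fires_occupied[OF w(2)] nbrs'[OF w(1)] fin s0 by (simp add: P_def)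
    have mw: "card (A - P) \<le> card (mobile_at k N s0 w)" and Ane: "A - P \<noteq> {}"
      using w nbrs' s0 by (auto simp: fires_def)
    have vw: "v \<noteq> w" using v w disjoint by blast
    have "card (mobile_at k N s0 v \<union> mobile_at k N s0 w) + card (P - {v, w}) \<le> N"
      using card_occupied_bound[of "{..<N}" P L "mobile_at k N s0 v \<union> mobile_at k N s0 w" "{v,w}"]
      by (auto simp: P_def mobile_at_def s0)
    moreover have "card (mobile_at k N s0 v \<union> mobile_at k N s0 w)
        = card (mobile_at k N s0 v) + card (mobile_at k N s0 w)"
      using vw by (intro card_Un_disjoint finite_mobile_at) (auto simp: mobile_at_def)
    moreover have "card (P - {v, w}) = card P - 2"
      using vP wP vw by (subst card_Diff_subset) auto
    \<comment> \<open>Makes the truncated subtraction \<open>card P - 2\<close> exact.\<close>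
    moreover have "card {v, w} \<le> card P"
      using vP wP finP by (intro card_mono) auto
    \<comment> \<open>So \<open>card A >= 2\<close>, which is what turns
      \<open>N >= card A + card B - 2\<close> into the claim.\<close>
    moreover have "card (A \<inter> P) > 0" "card (A - P) > 0"
      using v vP Ane fin by (auto simp: card_gt_0_iff)
    ultimately show ?thesis
      using vw mv mw cA cB cP by simp
  next
    case noB: False
    obtain M where M: "\<forall>i\<in>M. \<exists>v. fires k G N s0 v \<and> i \<in> mobile_at k N s0 v \<and>
        location s i \<in> unprotected_nbrs G s0 v"
     "\<forall>i. i \<notin> M \<longrightarrow> location s i = location s0 i"
     "\<forall>v. fires k G N s0 v \<longrightarrow>
        unprotected_nbrs G s0 v \<subseteq> location s ` (M \<inter> mobile_at k N s0 v)"
     "protected_verts s = protected_verts s0 \<union> location s ` M"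
      using st unfolding stage_def by blast
    \<comment> \<open>All moves go from \<open>A\<close> to \<open>B\<close>: searchers starting on
      \<open>B\<close> stay there, and \<open>A\<close> gains no protected vertex.\<close>
    have MA: "L i \<in> A \<and> location s i \<in> B" if i: "i \<in> M" for i
    proof -
      obtain v where v: "fires k G N s0 v" "i \<in> mobile_at k N s0 v"
        "location s i \<in> unprotected_nbrs G s0 v"
        using M(1) i by blast
      then have "v \<in> A" using noB verts by (auto simp: fires_def)
      then show ?thesis using v nbrs s0 by (auto simp: mobile_at_def)
    qed
    have prot: "A - protected_verts s = A - P"
      using M(4) MA disjoint s0 by auto
    show ?thesis
    proof (cases "verts G \<subseteq> protected_verts s")
      case True
      then have "A \<inter> P = A" using prot verts by blast
      then show ?thesis using 1 by simp
    next
      case False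
      obtain u where u: "fires k G N s u"
        using stages_step[OF rest False final] by blast
      \<comment> \<open>With \<open>B\<close> protected, no vertex of \<open>A\<close> has an
        unprotected neighbour.\<close>
      have uB: "u \<in> B"
        using u nbrs[of u s] Bprot verts by (auto simp: fires_def)
      \<comment> \<open>Occupied, not merely protected: initial searchers on \<open>B\<close> have
        stayed, and those from \<open>v\<close> cover the rest.\<close>
      have "B \<subseteq> location s ` {..<N}"
      proof
        fix x assume x: "x \<in> B"
        show "x \<in> location s ` {..<N}"
        proof (cases "x \<in> P")
          case True
          then obtain i where "i < N" "L i = x" by (auto simp: P_def)
          moreover from this have "i \<notin> M" using MA x disjoint by blast
          ultimately show ?thesis using M(2) s0(1) by (metis image_eqI lessThan_iff)
        next
          case False
          then have "x \<in> unprotected_nbrs G s0 v" using nbrs[OF v(2)] s0 x by simp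
          then have "x \<in> location s ` (M \<inter> mobile_at k N s0 v)"
            using M(3) v(1) by (meson subsetD)
          then show ?thesis
            by (auto simp: mobile_at_def)
        qed
      qed
      then have "card (mobile_at k N s u) + card (B - {u}) \<le> N"
        using card_occupied_bound[OF _ _ mobile_at_subset location_mobile_at, of N B s k u] by simp
      moreover have "card (A - P) \<le> card (mobile_at k N s u)"
        using u nbrs'[OF uB] prot by (simp add: fires_def)
      moreover have "card (B - {u}) + 1 = card B"
        using uB fin by (metis Suc_eq_plus1 card_Suc_Diff1)
      ultimately show ?thesis
        using 1 cA by linarith
    qed
  qed
qed

text \<open>If the first firing vertex lies in \<open>B\<close>, exchanging the parts gives
  \<open>2 * card A + card B <= 2 * N + 2\<close>, which is at least as strong because
  \<open>A\<close> is the larger part.\<close>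

lemma searchers_lower_bound:
  assumes "successful k G N L" "card B \<le> card A"
  shows "2 * card B + card A \<le> 2 * N + 2"
proof -
  obtain t where t: "(stage k G N)\<^sup>*\<^sup>* (initial_state N L) t" "verts G \<subseteq> protected_verts t"
    and lay: "is_layout G N L"
    using assms(1) by (auto simp: successful_def)
  show ?thesis
  proof (cases "verts G \<subseteq> protected_verts (initial_state N L)")
    case True
    then have "card (A \<union> B) \<le> N"
      using verts surj_card_le[of "{..<N}" "A \<union> B" L] by (simp add: initial_state_def)
    then show ?thesis
      using fin disjoint by (simp add: card_Un_disjoint)
  next
    case False
    obtain v s where v: "fires k G N (initial_state N L) v"
      and s: "stage k G N (initial_state N L) s" "(stage k G N)\<^sup>*\<^sup>* s t"
      using stages_step[OF t(1) False t(2)] by blast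
    then consider "v \<in> A" | "v \<in> B"
      using verts by (auto simp: fires_def)
    then show ?thesis
    proof cases
      case 1
      then show ?thesis
        using searchers_lower_bound_aux t lay s v by blast
    next
      case 2
      then have "2 * card A + card B \<le> 2 * N + 2"
        using bipartition.searchers_lower_bound_aux[OF swap] t lay s v by blast
      then show ?thesis using assms(2) by linarith
    qed
  qed
qed

section \<open>Complete bipartite graphs: upper bound and the exact value\<close>

text \<open>The searchers from \<open>A\<close> move twice, to \<open>u\<close> and back into
  \<open>A\<close>, hence \<open>k >= 2\<close>. Rounding \<open>card A / 2\<close> up leaves at
  most as many vertices of \<open>A\<close> free as there are returning searchers.\<close>

lemma successful_layout:
  assumes "k \<ge> 2" "card B \<ge> 1" "card A \<ge> 1" and N: "N = (card A + 1) div 2 + (card B - 1)"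
  shows "\<exists>L. successful k G N L"
proof -
  define a where "a = (card A + 1) div 2"
  have "a \<le> card A" "a \<ge> 1" "card A \<le> 2 * a"
    using assms by (auto simp: a_def)
  obtain A0 where A0: "A0 \<subseteq> A" "card A0 = a"
    using \<open>a \<le> card A\<close> by (meson obtain_subset_with_card_n)
  obtain u where u: "u \<in> B"
    using assms by fastforce
  have A0B: "A0 \<inter> (B - {u}) = {}" "finite A0"
    using A0 disjoint fin finite_subset by blast+
  have "card (A0 \<union> (B - {u})) = N"
    using A0 A0B u fin N by (subst card_Un_disjoint) (auto simp: a_def)
  then obtain L where L: "bij_betw L {..<N} (A0 \<union> (B - {u}))"
    using A0B fin by (metis ex_bij_betw_nat_finite finite_Diff finite_UnI lessThan_atLeast0)
  then have img: "L ` {..<N} = A0 \<union> (B - {u})"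
    by (simp add: bij_betw_def)
  define I where "I = {i. i < N \<and> L i \<in> A0}"
  have cI: "card I = a"
  proof -
    have "L ` I = A0" using img by (auto simp: I_def)
    moreover have "inj_on L I"
      using L by (auto simp: bij_betw_def I_def intro: inj_on_subset)
    ultimately show ?thesis using A0 by (metis card_image)
  qed
  let ?s = "initial_state N L"
  have fG: "finite (verts G)" "wf_digraph G"
    using fin verts graph by (auto simp: graph_def digraph_def fin_digraph_def)
  obtain t where t: "stage k G N ?s t"
    "\<And>v i. fires k G N ?s v \<Longrightarrow> i \<in> mobile_at k N ?s v \<Longrightarrow>
       location t i \<in> unprotected_nbrs G ?s v \<and> moves t i = Suc (moves ?s i)"
    using ex_stage_moving_all[OF fG] by blast
  have Bu: "unprotected_nbrs G ?s v = {u}" if "v \<in> A" for v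
    using nbrs[OF that] u img A0 disjoint by (auto simp: initial_state_def)
  have mob: "i \<in> mobile_at k N ?s (L i)" if "i \<in> I" for i
    using that assms by (auto simp: mobile_at_def I_def initial_state_def)
  \<comment> \<open>One searcher suffices, since \<open>u\<close> is the only unprotected
    neighbour.\<close>
  have fire: "fires k G N ?s (L i)" if i: "i \<in> I" for i
  proof -
    have "L i \<in> A" using i A0 by (auto simp: I_def)
    moreover have "card (mobile_at k N ?s (L i)) > 0"
      using mob[OF i] finite_mobile_at by (metis card_gt_0_iff empty_iff)
    ultimately show ?thesis
      using Bu verts by (simp add: fires_def)
  qed
  have I: "I \<subseteq> mobile_at k N t u"
  proof
    fix i assume i: "i \<in> I"
    then have "L i \<in> A" using A0 by (auto simp: I_def)
    then have "location t i = u \<and> moves t i = Suc (moves ?s i)"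
      using t(2)[OF fire[OF i] mob[OF i]] Bu by simp
    then show "i \<in> mobile_at k N t u"
      using i assms by (auto simp: mobile_at_def I_def initial_state_def)
  qed
  have "I \<noteq> {}" using cI \<open>a \<ge> 1\<close> by auto
  then obtain i where i: "i \<in> I" by blast
  have "L i \<in> A" using i A0 by (auto simp: I_def)
  then have Bt: "B \<subseteq> protected_verts t"
    using stage_protects[OF t(1) fire[OF i]] ends by blast
  have A0t: "A0 \<subseteq> protected_verts t"
    using stage_protected_mono[OF t(1)] img by (auto simp: initial_state_def)
  obtain t' where t': "stage k G N t t'"
    using ex_stage_moving_all[OF fG] by blast
  have "A \<subseteq> protected_verts t'"
  \<comment> \<open>\<open>A\<close> may already be complete: \<open>A0\<close> is all of
    \<open>A\<close> if \<open>card A = 1\<close>, and single searchers on \<open>B - {u}\<close>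
    also fire if \<open>A0\<close> misses just one vertex. Then \<open>u\<close> has nothing left to
    do.\<close>
  proof (cases "A \<subseteq> protected_verts t")
    case True
    then show ?thesis using stage_protected_mono[OF t'] by blast
  next
    case False
    have "card (A - protected_verts t) \<le> card (A - A0)"
      using A0t fin by (intro card_mono) auto
    also have "\<dots> \<le> a"
      using A0 A0B \<open>card A \<le> 2 * a\<close> by (simp add: card_Diff_subset)
    also have "\<dots> \<le> card (mobile_at k N t u)"
      using card_mono[OF finite_mobile_at I] cI by simp
    finally have "fires k G N t u"
      using False u verts nbrs'[OF u] by (auto simp: fires_def)
    then show ?thesis
      using stage_protects[OF t'] u ends by blast
  qed
  then have "verts G \<subseteq> protected_verts t'"
    using Bt stage_protected_mono[OF t'] verts by blast
  moreover have "(stage k G N)\<^sup>*\<^sup>* ?s t'"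
    using rtranclp.rtrancl_into_rtrancl[OF r_into_rtranclp] t(1) t' .
  moreover have "is_layout G N L"
    using img A0 verts by (auto simp: is_layout_def)
  ultimately show ?thesis
    by (auto simp: successful_def)
qed

end

theorem theorem3p5:
  fixes k m n :: nat and G :: "('a, 'b) pre_digraph"
  assumes "k \<ge> 2" and "n \<ge> m" and "m \<ge> 1"
    and "K\<^bsub>m,n\<^esub> G"
  shows "int (deduction_number k G) = int m + \<lceil>real n / 2\<rceil> - 1"
proof -
  obtain B A where "graph G" "verts G = B \<union> A" "B \<inter> A = {}" and card: "card B = m" "card A = n"
    and "arcs_ends G = B \<times> A \<union> A \<times> B"
    using assms(4) by (auto simp: complete_bipartite_digraph_def)
  then interpret bipartition A B G
    \<comment> \<open>The smaller part, of size \<open>m\<close>, takes the role of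
      \<open>B\<close>.\<close>
    by (intro bipartition.intro) auto
  have "deduction_number k G = (n + 1) div 2 + (m - 1)"
    unfolding deduction_number_def
  proof (rule Least_equality)
    show "\<exists>L. successful k G ((n + 1) div 2 + (m - 1)) L"
      using successful_layout[OF assms(1)] assms card by simp
    \<comment> \<open>Halving \<open>2 * m + n <= 2 * N + 2\<close> and rounding up, as
      \<open>N\<close> is an integer.\<close>
    show "(n + 1) div 2 + (m - 1) \<le> N" if "\<exists>L. successful k G N L" for N
      using searchers_lower_bound that assms card by fastforce
  qed
  moreover have "\<lceil>real n / 2\<rceil> = int ((n + 1) div 2)"
    by (rule ceiling_unique) linarith+
  ultimately show ?thesis
    using assms(3) by simp
qed

end
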